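(* Let $\Gamma=(G,\sigma)$ be a signed graph of order $n\geq 2$. Then $$\eta(\Gamma)\leq p(\Gamma)+2\theta(\Gamma).$$ Moreover, $$\eta(\Gamma)\leq p(\Gamma)+2\theta(\Gamma)-1$$ if $p(\Gamma)\geq 1$, or $p(\Gamma)=0$ and two distinct cycles of $G$ have common vertices.
   Context: All graphs are finite and simple. A signed graph $\Gamma=(G,\sigma)$ consists of a simple graph $G=(V(G),E(G))$ (the underlying graph), not necessarily connected, and a sign function $\sigma:E(G)\to\{+,-\}$. Its order is $n=|V(G)|$. Graph-theoretic notions for $\Gamma$ (degree, cycles, components) refer to $G$. The adjacency matrix $A(\Gamma)$ is the real symmetric matrix indexed by $V(G)$ whose $(u,v)$ entry is $+1$ if $uv\in E(G)$ and $\sigma(uv)=+$, $-1$ if $uv\in E(G)$ and $\sigma(uv)=-$, and $0$ if $uv\notin E(G)$. The nullity $\eta(\Gamma)$ is the number of zero eigenvalues of $A(\Gamma)$, counted with multiplicity. The cyclomatic number is $\theta(\Gamma)=|E(G)|-|V(G)|+c(G)$, where $c(G)$ is the number of connected components of $G$. A pendant vertex is a vertex of degree $1$, and $p(\Gamma)$ denotes the number of pendant vertices of $\Gamma$.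
   Formalization: The formal theorem additionally assumes that G has no isolated vertices; without this the claim fails, e.g. for two isolated vertices, where the nullity is 2 but p + 2θ = 0. Disconnected graphs are still allowed. *)

theory Defs
  imports "Jordan_Normal_Form.Char_Poly"
begin

text \<open>
  A signed graph is given by a vertex set \<open>V\<close>, a set \<open>E\<close> of two-element subsets of \<open>V\<close>, and a sign
  function \<open>\<sigma>\<close>. The function \<open>\<sigma>\<close> is total; only its values on members of \<open>E\<close> are ever used.
\<close>

datatype edge_sign = Plus | Minus

definition simple_graph :: "'v set \<Rightarrow> 'v set set \<Rightarrow> bool" where
  "simple_graph V E \<longleftrightarrow> finite V \<and> (\<forall>e\<in>E. e \<subseteq> V \<and> card e = 2)"

definition adjacency :: "'v set set \<Rightarrow> ('v set \<Rightarrow> edge_sign) \<Rightarrow> 'v \<Rightarrow> 'v \<Rightarrow> real" where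
  "adjacency E \<sigma> u v =
     (if {u, v} \<in> E then (case \<sigma> {u, v} of Plus \<Rightarrow> 1 | Minus \<Rightarrow> - 1) else 0)"

text \<open>
  Matrices have index set \<open>{0..<n}\<close>, so rows and columns are labelled through an arbitrary fixed
  listing of \<open>V\<close>. Another listing gives a matrix conjugate by a permutation matrix, hence with the
  same characteristic polynomial.
\<close>

definition vertex_listing :: "'v set \<Rightarrow> 'v list" where
  "vertex_listing V = (SOME vs. distinct vs \<and> set vs = V)"

definition adjacency_matrix ::
    "'v set \<Rightarrow> 'v set set \<Rightarrow> ('v set \<Rightarrow> edge_sign) \<Rightarrow> real mat" where
  "adjacency_matrix V E \<sigma> =
     mat (card V) (card V)
       (\<lambda>(i, j). adjacency E \<sigma> (vertex_listing V ! i) (vertex_listing V ! j))"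

definition nullity :: "'v set \<Rightarrow> 'v set set \<Rightarrow> ('v set \<Rightarrow> edge_sign) \<Rightarrow> nat" where
  "nullity V E \<sigma> = order 0 (char_poly (adjacency_matrix V E \<sigma>))"

definition vertex_degree :: "'v set set \<Rightarrow> 'v \<Rightarrow> nat" where
  "vertex_degree E v = card {e \<in> E. v \<in> e}"

definition num_pendant :: "'v set \<Rightarrow> 'v set set \<Rightarrow> nat" where
  "num_pendant V E = card {v \<in> V. vertex_degree E v = 1}"

definition connected_rel :: "'v set \<Rightarrow> 'v set set \<Rightarrow> ('v \<times> 'v) set" where
  "connected_rel V E = {(u, v). u \<in> V \<and> v \<in> V \<and> (u, v) \<in> {(x, y). {x, y} \<in> E}\<^sup>*}"

definition num_components :: "'v set \<Rightarrow> 'v set set \<Rightarrow> nat" where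
  "num_components V E = card (V // connected_rel V E)"

definition cyclomatic :: "'v set \<Rightarrow> 'v set set \<Rightarrow> int" where
  "cyclomatic V E = int (card E) - int (card V) + int (num_components V E)"

text \<open>
  A cycle is a subgraph without isolated vertices, so it is represented by its edge set \<open>C\<close>; its
  vertex set is \<open>\<Union>C\<close>. In particular, listings that differ by a rotation or a reflection describe
  the same cycle.
\<close>

definition is_cycle :: "'v set set \<Rightarrow> 'v set set \<Rightarrow> bool" where
  "is_cycle E C \<longleftrightarrow>
     (\<exists>vs. 3 \<le> length vs \<and> distinct vs \<and>
       C = {{vs ! i, vs ! (Suc i mod length vs)} | i. i < length vs} \<and> C \<subseteq> E)"

end

theory Submission
  imports Defs "Jordan_Normal_Form.Schur_Decomposition"
begin

text \<open>
  If every kernel vector of the symmetric matrix \<open>A(\<Gamma>)\<close> vanishing on a vertex set \<open>S\<close> is zero, then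
  \<open>\<eta>(\<Gamma>) \<le> |S|\<close>. Without isolated vertices, \<open>p + 2\<theta> = 2c + \<Sum>\<^sub>v max(d(v) - 2, 0)\<close>, so it suffices to
  find such an \<open>S\<close> component by component, at cost \<open>2\<close> plus \<open>max(d(v) - 2, 0)\<close> per vertex. Grow a set
  of processed vertices along edges: processing \<open>v\<close> puts all but one of its not yet determined
  neighbours into \<open>S\<close>, and the kernel equation at \<open>v\<close> determines the last one. Every vertex but the
  first has a processed neighbour and thus costs at most \<open>max(d(v) - 2, 0)\<close>; the first one costs
  \<open>max(d(v), 1)\<close>, counting itself. One unit is saved by starting at a pendant vertex, or by going
  around a cycle and closing it at a vertex of degree at least \<open>3\<close>, where two neighbours are already
  processed.
\<close>

subsection \<open>Zero as an eigenvalue of a real symmetric matrix\<close>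

text \<open>Put \<open>y = C x\<close>, where \<open>C\<close> is \<open>A\<close> with complex
  entries. Since \<open>C\<close> is real and symmetric, the squared norm of \<open>y\<close> is the
  product of \<open>C (conjugate y)\<close> with \<open>x\<close>, and
  \<open>C (conjugate y)\<close> is the conjugate of \<open>C y = 0\<close>. Hence
  \<open>y = 0\<close>.\<close>

lemma symmetric_kernel_square:
  fixes A :: "real mat"
  assumes A: "A \<in> carrier_mat n n" and sym: "transpose_mat A = A"
    and x: "x \<in> carrier_vec n"
    and zero: "map_mat complex_of_real A *\<^sub>v (map_mat complex_of_real A *\<^sub>v x) = 0\<^sub>v n"
  shows "map_mat complex_of_real A *\<^sub>v x = 0\<^sub>v n"
proof -
  define C where "C = map_mat complex_of_real A"
  have C: "C \<in> carrier_mat n n" using A by (simp add: C_def)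
  have Ct: "transpose_mat C = C"
    using sym unfolding C_def by (metis map_mat_transpose)
  define y where "y = C *\<^sub>v x"
  have y: "y \<in> carrier_vec n" using C x by (simp add: y_def)
  have "C *\<^sub>v conjugate y = conjugate (C *\<^sub>v y)"
    using C y A
    by (intro eq_vecI) (auto simp: C_def scalar_prod_def sum_conjugate conjugate_dist_mul)
  then have conj: "C *\<^sub>v conjugate y = 0\<^sub>v n"
    using zero by (simp add: C_def y_def)
  have "y \<bullet> conjugate y = conjugate y \<bullet> (C *\<^sub>v x)"
    using y by (metis comm_scalar_prod carrier_vec_conjugate y_def)
  also have "\<dots> = (C *\<^sub>v conjugate y) \<bullet> x"
    using transpose_vec_mult_scalar[OF C x carrier_vec_conjugate[OF y]] Ct by simp
  also have "\<dots> = 0" using conj x by simp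
  finally show ?thesis
    using conjugate_square_eq_0_vec[OF y] by (simp add: y_def C_def)
qed

lemma index_mult_mat_vec_sum:
  assumes "A \<in> carrier_mat nr n" "v \<in> carrier_vec n" "i < nr"
  shows "(A *\<^sub>v v) $ i = (\<Sum>c<n. A $$ (i, c) * v $ c)"
  using assms by (auto simp: scalar_prod_def lessThan_atLeast0 intro!: sum.cong)

text \<open>A dimension count: \<open>m\<close> coordinates are free and fewer than \<open>m\<close>
  homogeneous conditions are imposed on them. The solution is a kernel vector of a singular square
  matrix.\<close>

lemma exists_vec_finitely_many_constraints:
  fixes P :: "'a :: field mat"
  assumes P: "P \<in> carrier_mat n n" and S: "S \<subseteq> {..<n}" and m: "card S < m" "m \<le> n"
  obtains w where "w \<in> carrier_vec n" "w \<noteq> 0\<^sub>v n" "\<And>i. m \<le> i \<Longrightarrow> i < n \<Longrightarrow> w $ i = 0"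
    "\<And>s. s \<in> S \<Longrightarrow> (P *\<^sub>v w) $ s = 0"
proof -
  have fin: "finite S" using S finite_subset by auto
  obtain ss where ss: "set ss = S" "distinct ss" using finite_distinct_list[OF fin] by auto
  then have len: "length ss = card S" using distinct_card by force
  \<comment> \<open>The rows from \<open>m\<close> on annihilate the tail of \<open>w\<close>, the
    first \<open>card S\<close> rows are the conditions, and the rows in between are zero. Row
    \<open>card S\<close> is among these because \<open>card S < m\<close>, so \<open>M\<close> is
    singular.\<close>
  define M where "M = mat n n (\<lambda>(r, c). if m \<le> r then (if r = c then 1 else 0)
    else if r < length ss then P $$ (ss ! r, c) else 0)"
  have M: "M \<in> carrier_mat n n" by (simp add: M_def)
  have u: "unit_vec n (card S) \<noteq> (0\<^sub>v n :: 'a vec)" using m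
    by (metis index_unit_vec(1) index_zero_vec(1) one_neq_zero order_less_le_trans)
  have "transpose_mat M *\<^sub>v unit_vec n (card S) = 0\<^sub>v n"
    using M m len by (intro eq_vecI) (auto simp: M_def)
  then have "det (transpose_mat M) = 0"
    using det_0_iff_vec_prod_zero[of "transpose_mat M" n] M u
    by (metis transpose_carrier_mat unit_vec_carrier)
  then have "det M = 0" using det_transpose[OF M] by simp
  then obtain w where w: "w \<in> carrier_vec n" "w \<noteq> 0\<^sub>v n" "M *\<^sub>v w = 0\<^sub>v n"
    using det_0_iff_vec_prod_zero[OF M] by auto
  have row: "(\<Sum>c<n. M $$ (r, c) * w $ c) = 0" if "r < n" for r
    using index_mult_mat_vec_sum[OF M w(1) that] w(3) that by simp
  show thesis
  proof
    show "w $ i = 0" if i: "m \<le> i" "i < n" for i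
    proof -
      have "(\<Sum>c<n. M $$ (i, c) * w $ c) = (\<Sum>c<n. if i = c then w $ c else 0)"
        using i by (intro sum.cong) (auto simp: M_def)
      then show ?thesis using row[of i] i by simp
    qed
    show "(P *\<^sub>v w) $ s = 0" if s: "s \<in> S" for s
    proof -
      obtain r where r: "r < length ss" "ss ! r = s" using s ss by (metis in_set_conv_nth)
      have "(P *\<^sub>v w) $ s = (\<Sum>c<n. P $$ (s, c) * w $ c)"
        using S s by (intro index_mult_mat_vec_sum[OF P w(1)]) auto
      also have "\<dots> = (\<Sum>c<n. M $$ (r, c) * w $ c)"
        using r len m by (intro sum.cong) (auto simp: M_def)
      finally show ?thesis using row[of r] r len m by simp
    qed
  qed (use w in auto)
qed

text \<open>The Schur decomposition takes the eigenvalues in any prescribed order. Listing the zeros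
  first puts them at the top of the diagonal.\<close>

lemma char_poly_zero_roots_first:
  fixes C :: "complex mat"
  assumes C: "C \<in> carrier_mat n n"
  obtains es where "char_poly C = (\<Prod>e\<leftarrow>es. [:- e, 1:])"
    "length es = n" "Polynomial.order 0 (char_poly C) \<le> n" "\<And>i. i < Polynomial.order 0 (char_poly C) \<Longrightarrow> es ! i = 0"
proof -
  obtain as where as: "char_poly C = (\<Prod>a\<leftarrow>as. [:- a, 1:])" "length as = n"
    using char_poly_factorized[OF C] by auto
  define zs where "zs = filter (\<lambda>a. a = 0) as"
  define us where "us = filter (\<lambda>a. a \<noteq> 0) as"
  have "(\<Prod>a\<leftarrow>as. f a) = (\<Prod>a\<leftarrow>zs. f a) * (\<Prod>a\<leftarrow>us. f a)" for f :: "complex \<Rightarrow> complex poly"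
    unfolding zs_def us_def by (induction as) (auto simp: ac_simps)
  then have split: "char_poly C = (\<Prod>a\<leftarrow>zs. [:- a, 1:]) * (\<Prod>a\<leftarrow>us. [:- a, 1:])"
    using as by simp
  have z: "(\<Prod>a\<leftarrow>zs. [:- a, 1:]) = [:- 0, 1:] ^ length zs"
    unfolding zs_def by (induction as) auto
  have "poly (\<Prod>a\<leftarrow>us. [:- a, 1:]) 0 \<noteq> 0"
    unfolding us_def by (induction as) auto
  then have "Polynomial.order 0 (\<Prod>a\<leftarrow>us. [:- a, 1:]) = 0" "(\<Prod>a\<leftarrow>us. [:- a, 1:]) \<noteq> 0"
    by (auto simp: order_0I)
  then have ord: "Polynomial.order 0 (char_poly C) = length zs"
    unfolding split z
    using order_mult[of "[:- 0, 1:] ^ length zs" "\<Prod>a\<leftarrow>us. [:- a, 1:]" 0]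
      order_power_n_n[of "0 :: complex" "length zs"] by simp
  have len: "length zs + length us = n"
    using as(2) sum_length_filter_compl[of "\<lambda>a. a = 0" as] unfolding zs_def us_def by simp
  have "zs ! i = 0" if "i < length zs" for i
    using nth_mem[OF that] unfolding zs_def by simp
  then show thesis
    using that[of "zs @ us"] split ord len by (simp add: nth_append)
qed

text \<open>If 0 has multiplicity \<open>m\<close> over the complex numbers, then the first
  \<open>m\<close> columns of the invertible Schur matrix \<open>P\<close> lie in the kernel. If
  \<open>card S < m\<close>, some nonzero combination of them vanishes on \<open>S\<close>, against
  \<open>ker\<close>.\<close>

lemma order_char_poly_le_card:
  fixes A :: "real mat"
  assumes A: "A \<in> carrier_mat n n" and sym: "transpose_mat A = A" and S: "S \<subseteq> {..<n}"
    and ker: "\<And>x. x \<in> carrier_vec n \<Longrightarrow> A *\<^sub>v x = 0\<^sub>v n \<Longrightarrow> (\<And>s. s \<in> S \<Longrightarrow> x $ s = 0) \<Longrightarrow> x = 0\<^sub>v n"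
  shows "Polynomial.order 0 (char_poly A) \<le> card S"
proof (rule ccontr)
  assume less: "\<not> ?thesis"
  define C where "C = map_mat complex_of_real A"
  have C: "C \<in> carrier_mat n n" using A by (simp add: C_def)
  define m where "m = Polynomial.order 0 (char_poly C)"
  interpret h: map_poly_comm_ring_hom complex_of_real ..
  \<comment> \<open>The Schur form needs a split characteristic polynomial, hence complex entries.
    Divisibility by a power of the variable survives the embedding, so \<open>m\<close> is at least
    the real multiplicity.\<close>
  have "[:- 0, 1:] ^ Polynomial.order 0 (char_poly A) dvd char_poly A" by (rule order_1)
  then have "map_poly complex_of_real ([:- 0, 1:] ^ Polynomial.order 0 (char_poly A)) dvd
      map_poly complex_of_real (char_poly A)"
    by (rule h.hom_dvd)
  then have "[:- 0, 1:] ^ Polynomial.order 0 (char_poly A) dvd char_poly C"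
    unfolding C_def of_real_hom.char_poly_hom[OF A] by (simp add: hom_distribs)
  moreover have "char_poly C \<noteq> 0"
    using degree_monic_char_poly[OF C] by auto
  ultimately have m: "card S < m" using less unfolding m_def order_divides by auto
  obtain es where es: "char_poly C = (\<Prod>e\<leftarrow>es. [:- e, 1:])" "length es = n" "m \<le> n"
    "\<And>i. i < m \<Longrightarrow> es ! i = 0"
    using char_poly_zero_roots_first[OF C] unfolding m_def by metis
  obtain B P Q where BPQ: "schur_decomposition C es = (B, P, Q)" by (cases "schur_decomposition C es")
  from schur_decomposition[OF C es(1) BPQ]
  have wit: "similar_mat_wit C B P Q" and up: "upper_triangular B" and diag: "diag_mat B = es" by auto
  from similar_mat_witD2[OF C wit]
  have P: "P \<in> carrier_mat n n" and Q: "Q \<in> carrier_mat n n" and B: "B \<in> carrier_mat n n"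
    and PQ: "P * Q = 1\<^sub>m n" and QP: "Q * P = 1\<^sub>m n" and CPBQ: "C = P * B * Q" by auto
  have CP: "C * P = P * B"
    unfolding CPBQ using P B Q QP by (simp add: assoc_mult_mat[of _ n n _ n _ n])
  \<comment> \<open>By induction on the columns: a zero diagonal entry gives \<open>C\<^sup>2 p\<^sub>j = 0\<close>, and symmetry lowers the exponent.\<close>
  have col0: "C *\<^sub>v col P j = 0\<^sub>v n" if "j < m" for j
    using that
  proof (induction j rule: less_induct)
    case (less j)
    have jn: "j < n" using less.prems es(3) by simp
    have pj: "col P j \<in> carrier_vec n" using P by auto
    have "C *\<^sub>v (C *\<^sub>v col P j) = C *\<^sub>v (P *\<^sub>v col B j)"
      using col_mult2[OF C P jn] col_mult2[OF P B jn] CP by simp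
    also have "\<dots> = (C * P) *\<^sub>v col B j"
      using C P B by (metis assoc_mult_mat_vec carrier_matD(1) carrier_vecI dim_col)
    also have "\<dots> = 0\<^sub>v n"
    proof (rule eq_vecI)
      fix k assume "k < dim_vec (0\<^sub>v n :: complex vec)"
      then have k: "k < n" by simp
      \<comment> \<open>For \<open>i < j\<close> the induction hypothesis makes column
        \<open>i\<close> of \<open>C * P\<close> zero. For \<open>i > j\<close> the entry of
        \<open>B\<close> is zero by triangularity, and for \<open>i = j\<close> it is
        \<open>es ! j = 0\<close>.\<close>
      have "(C * P) $$ (k, i) * B $$ (i, j) = 0" if i: "i < n" for i
      proof (cases "i < j")
        case True
        then have "(C *\<^sub>v col P i) $ k = 0" using less k by simp
        then show ?thesis using col_mult2[OF C P i] C P k i by (simp add: index_mult_mat)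
      next
        case False
        have "B $$ (j, j) = 0"
          using diag es(4)[OF less.prems] es(2) jn B unfolding diag_mat_def by auto
        then have "B $$ (i, j) = 0" using False up i B by (cases "i = j") auto
        then show ?thesis by simp
      qed
      then show "(C * P *\<^sub>v col B j) $ k = 0\<^sub>v n $ k"
        using index_mult_mat_vec_sum[of "C * P" n n "col B j" k] C P B k jn
        by (simp del: index_mult_mat index_mult_mat_vec add: sum.neutral)
    qed (use C in auto)
    finally show ?case
      using symmetric_kernel_square[OF A sym pj] by (simp add: C_def)
  qed
  obtain w where w: "w \<in> carrier_vec n" "w \<noteq> 0\<^sub>v n" "\<And>i. m \<le> i \<Longrightarrow> i < n \<Longrightarrow> w $ i = 0"
    "\<And>s. s \<in> S \<Longrightarrow> (P *\<^sub>v w) $ s = 0"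
    using exists_vec_finitely_many_constraints[OF P S m es(3)] by blast
  define x where "x = P *\<^sub>v w"
  have x: "x \<in> carrier_vec n" using P w by (simp add: x_def)
  have "Q *\<^sub>v x = w"
    unfolding x_def using assoc_mult_mat_vec[OF Q P w(1)] QP w by simp
  then have x0: "x \<noteq> 0\<^sub>v n" using w Q by auto
  have "C *\<^sub>v x = (C * P) *\<^sub>v w"
    unfolding x_def using assoc_mult_mat_vec[OF C P w(1)] by simp
  also have "\<dots> = 0\<^sub>v n"
  proof (rule eq_vecI)
    fix k assume "k < dim_vec (0\<^sub>v n :: complex vec)"
    then have k: "k < n" by simp
    have "(C * P) $$ (k, i) * w $ i = 0" if i: "i < n" for i
    proof (cases "i < m")
      case True
      then have "(C *\<^sub>v col P i) $ k = 0" using col0 k by simp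
      then show ?thesis using C P k i by simp
    qed (use w i in auto)
    then show "(C * P *\<^sub>v w) $ k = 0\<^sub>v n $ k"
      using index_mult_mat_vec_sum[of "C * P" n n w k] C P k w(1)
      by (simp del: index_mult_mat index_mult_mat_vec add: sum.neutral)
  qed (use C in auto)
  finally have Cx: "C *\<^sub>v x = 0\<^sub>v n" .
  have Cxk: "(\<Sum>i<n. of_real (A $$ (k, i)) * x $ i) = 0" if k: "k < n" for k
    using index_mult_mat_vec_sum[OF C x k] Cx k A
    by (simp add: C_def del: index_mult_mat_vec)
  \<comment> \<open>As \<open>A\<close> is real, the real and imaginary parts of \<open>x\<close>
    lie in its kernel separately, and both vanish on \<open>S\<close>.\<close>
  have "vec n (\<lambda>i. Re (x $ i)) = 0\<^sub>v n"
  proof (rule ker)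
    have "(\<Sum>i<n. A $$ (k, i) * Re (x $ i)) = 0" if k: "k < n" for k
      using arg_cong[OF Cxk[OF k], of Re] by simp
    then show "A *\<^sub>v vec n (\<lambda>i. Re (x $ i)) = 0\<^sub>v n"
      using A by (intro eq_vecI) (auto simp: scalar_prod_def lessThan_atLeast0)
  qed (use S w in \<open>auto simp: x_def\<close>)
  moreover have "vec n (\<lambda>i. Im (x $ i)) = 0\<^sub>v n"
  proof (rule ker)
    have "(\<Sum>i<n. A $$ (k, i) * Im (x $ i)) = 0" if k: "k < n" for k
      using arg_cong[OF Cxk[OF k], of Im] by simp
    then show "A *\<^sub>v vec n (\<lambda>i. Im (x $ i)) = 0\<^sub>v n"
      using A by (intro eq_vecI) (auto simp: scalar_prod_def lessThan_atLeast0)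
  qed (use S w in \<open>auto simp: x_def\<close>)
  ultimately have "x = 0\<^sub>v n"
    using x by (intro eq_vecI) (auto simp: complex_eq_iff vec_eq_iff)
  then show False using x0 by simp
qed

subsection \<open>Vertex sets determining the kernel\<close>

locale signed_graph =
  fixes V :: "'v set" and E :: "'v set set" and \<sigma> :: "'v set \<Rightarrow> edge_sign"
  assumes simple: "simple_graph V E"
begin

lemma finite_V: "finite V"
  using simple by (simp add: simple_graph_def)

lemma finite_E: "finite E"
proof (rule finite_subset)
  show "E \<subseteq> Pow V" using simple by (auto simp: simple_graph_def)
qed (simp add: finite_V)

lemma edge_endpoints:
  assumes "{u, v} \<in> E"
  shows "u \<in> V" "v \<in> V" "u \<noteq> v"
  using simple assms by (force simp: simple_graph_def)+

section \<open>Neighbourhoods and degree counts\<close>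

definition nbhd :: "'v \<Rightarrow> 'v set" where
  "nbhd v = {u. {v, u} \<in> E}"

lemma nbhd_subset: "nbhd v \<subseteq> V"
  using edge_endpoints by (auto simp: nbhd_def)

lemma finite_nbhd: "finite (nbhd v)"
  using nbhd_subset finite_V finite_subset by metis

lemma nbhd_sym: "u \<in> nbhd v \<longleftrightarrow> v \<in> nbhd u"
  by (simp add: nbhd_def insert_commute)

lemma vertex_degree_eq_card_nbhd: "vertex_degree E v = card (nbhd v)"
proof -
  have "{e \<in> E. v \<in> e} = (\<lambda>u. {v, u}) ` nbhd v"
  proof
    show "{e \<in> E. v \<in> e} \<subseteq> (\<lambda>u. {v, u}) ` nbhd v"
    proof
      fix e assume e: "e \<in> {e \<in> E. v \<in> e}"
      then have "card e = 2" using simple by (auto simp: simple_graph_def)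
      then obtain a b where "e = {a, b}" by (auto simp: card_2_iff)
      then have "\<exists>u. e = {v, u}" using e by auto
      then show "e \<in> (\<lambda>u. {v, u}) ` nbhd v" using e by (auto simp: nbhd_def)
    qed
  qed (auto simp: nbhd_def)
  moreover have "inj_on (\<lambda>u. {v, u}) (nbhd v)"
    by (auto simp: inj_on_def doubleton_eq_iff)
  ultimately show ?thesis
    by (simp add: vertex_degree_def card_image)
qed

lemma sum_vertex_degree: "(\<Sum>v\<in>V. vertex_degree E v) = 2 * card E"
proof -
  have "(\<Sum>v\<in>V. vertex_degree E v) = (\<Sum>v\<in>V. \<Sum>e\<in>E. if v \<in> e then 1 else 0)"
    using finite_E by (simp add: vertex_degree_def sum.If_cases Int_def conj_commute)
  also have "\<dots> = (\<Sum>e\<in>E. \<Sum>v\<in>V. if v \<in> e then 1 else 0)"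
    by (rule sum.swap)
  also have "\<dots> = (\<Sum>e\<in>E. 2)"
  proof (rule sum.cong)
    fix e assume "e \<in> E"
    then have "e \<subseteq> V" "card e = 2" using simple by (auto simp: simple_graph_def)
    then show "(\<Sum>v\<in>V. if v \<in> e then 1 else 0) = (2 :: nat)"
      using finite_V by (simp add: sum.If_cases Int_absorb1)
  qed simp
  finally show ?thesis by simp
qed

text \<open>For degree \<open>d \<ge> 1\<close> the truncated \<open>d - 2\<close> is the true
  difference, plus 1 exactly when \<open>d = 1\<close>. Summing with the handshake identity gives
  \<open>2|E| - 2|V| + p\<close>. At an isolated vertex the truncation would be off by 2.\<close>

lemma pendant_cyclomatic_eq:
  assumes "\<forall>v\<in>V. vertex_degree E v \<noteq> 0"
  shows "int (num_pendant V E) + 2 * cyclomatic V E =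
    2 * int (num_components V E) + int (\<Sum>v\<in>V. vertex_degree E v - 2)"
proof -
  have "int (\<Sum>v\<in>V. vertex_degree E v - 2) =
      (\<Sum>v\<in>V. int (vertex_degree E v) - 2 + (if vertex_degree E v = 1 then 1 else 0))"
    unfolding of_nat_sum
  proof (rule sum.cong)
    fix v assume "v \<in> V"
    then have "vertex_degree E v \<noteq> 0" using assms by simp
    then show "int (vertex_degree E v - 2) =
        int (vertex_degree E v) - 2 + (if vertex_degree E v = 1 then 1 else 0)"
      by auto
  qed simp
  also have "\<dots> = int (\<Sum>v\<in>V. vertex_degree E v) - 2 * int (card V) + int (num_pendant V E)"
    using finite_V
    by (simp add: sum.distrib sum_subtractf num_pendant_def sum.If_cases Int_def)
  finally show ?thesis
    by (simp add: sum_vertex_degree cyclomatic_def)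
qed

section \<open>Sets that determine kernel vectors, and the nullity\<close>

definition determines :: "'v set \<Rightarrow> 'v set \<Rightarrow> bool" where
  "determines S T \<longleftrightarrow>
     (\<forall>x. (\<forall>v\<in>V. (\<Sum>u\<in>V. adjacency E \<sigma> v u * x u) = 0) \<and> (\<forall>s\<in>S. x s = 0) \<longrightarrow> (\<forall>t\<in>T. x t = 0))"

lemma determines_mono: "determines S T \<Longrightarrow> S \<subseteq> S' \<Longrightarrow> T' \<subseteq> T \<Longrightarrow> determines S' T'"
  unfolding determines_def by blast

lemma determines_Un: "determines S T \<Longrightarrow> determines S T' \<Longrightarrow> determines S (T \<union> T')"
  unfolding determines_def by blast

lemma determines_UN: "(\<And>i. i \<in> I \<Longrightarrow> determines S (T i)) \<Longrightarrow> determines S (\<Union>i\<in>I. T i)"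
  unfolding determines_def by blast

text \<open>The colour-change rule of zero forcing: in the kernel equation at \<open>v\<close> every
  term except that of \<open>w\<close> vanishes, and the coefficient of \<open>w\<close> is 1 or
  -1.\<close>

lemma determines_force:
  assumes det: "determines S T" and v: "v \<in> V" and w: "w \<in> nbhd v" and T: "nbhd v - {w} \<subseteq> T"
  shows "determines S (insert w T)"
  unfolding determines_def
proof (intro allI impI)
  fix x assume x: "(\<forall>v\<in>V. (\<Sum>u\<in>V. adjacency E \<sigma> v u * x u) = 0) \<and> (\<forall>s\<in>S. x s = 0)"
  then have xT: "\<forall>t\<in>T. x t = 0" using det unfolding determines_def by blast
  have wV: "w \<in> V" using w nbhd_subset by auto
  have "adjacency E \<sigma> v u * x u = 0" if "u \<in> V - {w}" for u
    using that T xT by (cases "u \<in> nbhd v") (auto simp: nbhd_def adjacency_def)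
  then have "(\<Sum>u\<in>V - {w}. adjacency E \<sigma> v u * x u) = 0"
    by (intro sum.neutral) auto
  then have "(\<Sum>u\<in>V. adjacency E \<sigma> v u * x u) = adjacency E \<sigma> v w * x w"
    using sum.remove[OF finite_V wV, of "\<lambda>u. adjacency E \<sigma> v u * x u"] by simp
  moreover have "adjacency E \<sigma> v w \<noteq> 0"
    using w by (auto simp: nbhd_def adjacency_def split: edge_sign.split)
  ultimately have "x w = 0" using x v by auto
  then show "\<forall>t\<in>insert w T. x t = 0" using xT by simp
qed

lemma nullity_le_card:
  assumes det: "determines S V" and S: "S \<subseteq> V"
  shows "nullity V E \<sigma> \<le> card S"
proof -
  define n where "n = card V"
  define f where "f i = vertex_listing V ! i" for i
  have "\<exists>vs. distinct vs \<and> set vs = V"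
    using finite_distinct_list[OF finite_V] by auto
  then have vl: "distinct (vertex_listing V) \<and> set (vertex_listing V) = V"
    unfolding vertex_listing_def by (rule someI_ex)
  then have "length (vertex_listing V) = n" unfolding n_def using distinct_card by fastforce
  then have bij: "bij_betw f {..<n} V"
    using bij_betw_nth[of "vertex_listing V" "{..<n}" V] vl unfolding f_def by simp
  define A where "A = adjacency_matrix V E \<sigma>"
  have A: "A \<in> carrier_mat n n" by (simp add: A_def adjacency_matrix_def n_def)
  have Aij: "A $$ (i, j) = adjacency E \<sigma> (f i) (f j)" if "i < n" "j < n" for i j
    using that by (simp add: A_def adjacency_matrix_def n_def f_def)
  have sym: "transpose_mat A = A"
    using A by (intro eq_matI) (auto simp: Aij adjacency_def insert_commute)
  define S' where "S' = {i \<in> {..<n}. f i \<in> S}"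
  have fS': "f ` S' = S" using bij S unfolding S'_def bij_betw_def by auto
  have "Polynomial.order 0 (char_poly A) \<le> card S'"
  proof (rule order_char_poly_le_card[OF A sym])
    fix x :: "real vec"
    assume x: "x \<in> carrier_vec n" "A *\<^sub>v x = 0\<^sub>v n" "\<And>s. s \<in> S' \<Longrightarrow> x $ s = 0"
    \<comment> \<open>The vector is carried back along the listing to a function on
      \<open>V\<close>, the form of kernel vector used by \<open>determines\<close>.\<close>
    define y where "y v = x $ (the_inv_into {..<n} f v)" for v
    have y: "y (f i) = x $ i" if "i < n" for i
      using that bij by (simp add: y_def bij_betw_def the_inv_into_f_f)
    have "(\<Sum>u\<in>V. adjacency E \<sigma> v u * y u) = 0" if v: "v \<in> V" for v
    proof -
      obtain k where k: "k < n" "f k = v" using bij v by (auto simp: bij_betw_def)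
      have "(\<Sum>u\<in>V. adjacency E \<sigma> v u * y u) = (\<Sum>i<n. adjacency E \<sigma> v (f i) * y (f i))"
        by (rule sum.reindex_bij_betw[OF bij, symmetric])
      also have "\<dots> = (\<Sum>i<n. A $$ (k, i) * x $ i)"
        using k by (intro sum.cong) (auto simp: Aij y)
      also have "\<dots> = (A *\<^sub>v x) $ k"
        using index_mult_mat_vec_sum[OF A x(1) k(1)] by simp
      finally show ?thesis using x k by simp
    qed
    moreover have "y s = 0" if "s \<in> S" for s
    proof -
      obtain i where "i \<in> S'" "f i = s" using \<open>s \<in> S\<close> unfolding fS'[symmetric] by blast
      then show ?thesis using x(3) y[of i] by (auto simp: S'_def)
    qed
    ultimately have "\<forall>v\<in>V. y v = 0"
      using det unfolding determines_def by blast
    then show "x = 0\<^sub>v n"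
      using x y bij by (intro eq_vecI) (auto simp: bij_betw_def)
  qed (auto simp: S'_def)
  also have "card S' = card S"
    using card_image[of f S'] inj_on_subset[of f "{..<n}" S'] bij fS'
    by (simp add: bij_betw_def S'_def subset_iff)
  finally show ?thesis by (simp add: nullity_def A_def)
qed

section \<open>Processing vertices one at a time\<close>

definition closed_nbhd :: "'v set \<Rightarrow> 'v set" where
  "closed_nbhd P = P \<union> (\<Union>v\<in>P. nbhd v)"

lemma closed_nbhd_insert: "closed_nbhd (insert v P) = insert v (closed_nbhd P \<union> nbhd v)"
  by (auto simp: closed_nbhd_def)

text \<open>The set \<open>W\<close> of undetermined neighbours of \<open>v\<close> misses
  \<open>nbhd v \<inter> P\<close>. All of \<open>W\<close> but one vertex is added to
  \<open>S\<close>, and the equation at \<open>v\<close> forces the last. Assuming \<open>v\<close>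
  itself determined lets \<open>P = {}\<close> serve as the start.\<close>

lemma determines_insert:
  assumes v: "v \<in> V" and det: "determines S (insert v (closed_nbhd P))" and S: "S \<subseteq> V"
  obtains S' where "S' \<subseteq> V" "determines S' (closed_nbhd (insert v P))"
    "card S' \<le> card S + (vertex_degree E v - card (nbhd v \<inter> P) - 1)"
proof -
  define W where "W = nbhd v - closed_nbhd P"
  have finW: "finite W" using finite_nbhd by (simp add: W_def)
  have "W \<subseteq> nbhd v - nbhd v \<inter> P" by (auto simp: W_def closed_nbhd_def)
  then have "card W \<le> card (nbhd v - nbhd v \<inter> P)"
    using finite_nbhd by (intro card_mono) auto
  also have "\<dots> = vertex_degree E v - card (nbhd v \<inter> P)"
    using finite_nbhd by (subst card_Diff_subset) (auto simp: vertex_degree_eq_card_nbhd)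
  finally have cW: "card W \<le> vertex_degree E v - card (nbhd v \<inter> P)" .
  show thesis
  proof (cases "W = {}")
    case True
    then have "closed_nbhd (insert v P) \<subseteq> insert v (closed_nbhd P)"
      by (auto simp: closed_nbhd_insert W_def)
    then show thesis using that[of S] det S determines_mono by (metis le_add1 order_refl)
  next
    case False
    then obtain w where w: "w \<in> W" by auto
    define S' where "S' = S \<union> (W - {w})"
    have self: "determines S' (W - {w})"
      by (auto simp: S'_def determines_def)
    have "determines S' (insert v (closed_nbhd P))"
      using det determines_mono by (metis S'_def Un_upper1 order_refl)
    then have "determines S' (insert v (closed_nbhd P) \<union> (W - {w}))"
      using self determines_Un by blast
    then have "determines S' (insert w (insert v (closed_nbhd P) \<union> (W - {w})))"
      using w by (intro determines_force[OF _ v]) (auto simp: W_def)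
    then have "determines S' (closed_nbhd (insert v P))"
      by (rule determines_mono) (auto simp: W_def closed_nbhd_insert)
    moreover have "S' \<subseteq> V"
      using S nbhd_subset by (auto simp: S'_def W_def)
    moreover have "card S' \<le> card S + (card W - 1)"
      using w finW card_Un_le[of S "W - {w}"] by (simp add: S'_def)
    ultimately show thesis using that[of S'] cW by force
  qed
qed

text \<open>The constant \<open>c\<close> is the cost beyond the degree sum. By
  \<open>pendant_cyclomatic_eq\<close> the general bound allows 2 per component, so
  \<open>c = 1\<close> on one component is a saving.\<close>

definition budget :: "nat \<Rightarrow> 'v set \<Rightarrow> bool" where
  "budget c P \<longleftrightarrow> P \<subseteq> V \<and>
     (\<exists>S\<subseteq>V. determines S (closed_nbhd P) \<and> card S \<le> c + (\<Sum>v\<in>P. vertex_degree E v - 2))"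

text \<open>At the start \<open>v\<close> itself is put into \<open>S\<close>, for a total of
  \<open>1 + (d - 1)\<close>. This is 1 at a pendant vertex.\<close>

lemma budget_singleton:
  assumes "v \<in> V"
  shows "budget 2 {v}" "vertex_degree E v = 1 \<Longrightarrow> budget 1 {v}"
proof -
  have "determines {v} (insert v (closed_nbhd {}))"
    by (auto simp: determines_def closed_nbhd_def)
  then obtain S where S: "S \<subseteq> V" "determines S (closed_nbhd {v})"
    "card S \<le> 1 + (vertex_degree E v - 1)"
    using determines_insert[of v "{v}" "{}"] assms by auto
  show "budget 2 {v}"
    unfolding budget_def using S assms by (intro conjI exI[of _ S]) auto
  show "budget 1 {v}" if "vertex_degree E v = 1"
    unfolding budget_def using S assms that by (intro conjI exI[of _ S]) auto
qed

text \<open>A processed neighbour means that \<open>v\<close> is already determined, so only its new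
  neighbours cost anything. The premise \<open>le\<close> also admits \<open>c' < c\<close>, which
  is how a unit gets saved.\<close>

lemma budget_insert:
  assumes b: "budget c P" and v: "v \<in> V - P" and pos: "nbhd v \<inter> P \<noteq> {}"
    and le: "c + (vertex_degree E v - card (nbhd v \<inter> P) - 1) \<le> c' + (vertex_degree E v - 2)"
  shows "budget c' (insert v P)"
proof -
  obtain S where S: "S \<subseteq> V" "determines S (closed_nbhd P)"
    "card S \<le> c + (\<Sum>v\<in>P. vertex_degree E v - 2)" and P: "P \<subseteq> V"
    using b unfolding budget_def by auto
  have "insert v (closed_nbhd P) = closed_nbhd P"
    using pos nbhd_sym by (auto simp: closed_nbhd_def)
  then obtain S' where S': "S' \<subseteq> V" "determines S' (closed_nbhd (insert v P))"
    "card S' \<le> card S + (vertex_degree E v - card (nbhd v \<inter> P) - 1)"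
    using determines_insert[of v S P] S v by auto
  have "finite P" using P finite_V finite_subset by auto
  then have "(\<Sum>v\<in>insert v P. vertex_degree E v - 2) =
      (vertex_degree E v - 2) + (\<Sum>v\<in>P. vertex_degree E v - 2)"
    using v by simp
  then show ?thesis
    unfolding budget_def using S' S v P le by (intro conjI exI[of _ S']) auto
qed

lemma budget_insert_same:
  assumes "budget c P" "v \<in> V - P" "nbhd v \<inter> P \<noteq> {}"
  shows "budget c (insert v P)"
proof -
  have "card (nbhd v \<inter> P) \<ge> 1"
    using assms finite_nbhd by (simp add: Suc_le_eq card_gt_0_iff)
  then show ?thesis using assms by (intro budget_insert[of c]) auto
qed

text \<open>Two processed neighbours lower the cost at \<open>v\<close> to \<open>d - 3\<close>.
  This is less than \<open>d - 2\<close> in truncated subtraction only if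
  \<open>d \<ge> 3\<close>.\<close>

lemma budget_insert_saving:
  assumes "budget (Suc c) P" "v \<in> V - P" "a \<in> nbhd v \<inter> P" "b \<in> nbhd v \<inter> P" "a \<noteq> b"
    and "vertex_degree E v \<ge> 3"
  shows "budget c (insert v P)"
proof -
  have "card {a, b} \<le> card (nbhd v \<inter> P)"
    using assms finite_nbhd by (intro card_mono) auto
  then show ?thesis using assms by (intro budget_insert[of "Suc c"]) auto
qed

section \<open>Exhausting connected components\<close>

lemma equiv_connected_rel: "equiv V (connected_rel V E)"
proof (rule equivI)
  have "sym {(x, y). {x, y} \<in> E}" by (auto simp: sym_def insert_commute)
  then have "sym ({(x, y). {x, y} \<in> E}\<^sup>*)" by (rule sym_rtrancl)
  then show "sym (connected_rel V E)" by (auto simp: connected_rel_def sym_def)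
qed (auto simp: connected_rel_def refl_on_def trans_def)

lemma component_nbhd:
  assumes K: "K \<in> V // connected_rel V E" and u: "u \<in> K" and w: "w \<in> nbhd u"
  shows "w \<in> K"
proof -
  have "(u, w) \<in> connected_rel V E"
    using w edge_endpoints by (auto simp: connected_rel_def nbhd_def)
  then show ?thesis using K u equiv_connected_rel in_quotient_imp_closed by metis
qed

lemma component_exit:
  assumes K: "K \<in> V // connected_rel V E" and P: "P \<subseteq> K" "P \<noteq> {}" "P \<noteq> K"
  obtains v where "v \<in> K - P" "nbhd v \<inter> P \<noteq> {}"
proof -
  obtain p q where pq: "p \<in> P" "q \<in> K - P" using P by auto
  then have "(p, q) \<in> connected_rel V E"
    using quotient_eq_iff[OF equiv_connected_rel K K, of p q] P by auto
  then have "(p, q) \<in> {(x, y). {x, y} \<in> E}\<^sup>*" by (simp add: connected_rel_def)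
  \<comment> \<open>Induction along the path: it stays in \<open>P\<close> until some edge leaves
    \<open>P\<close>.\<close>
  then have "q \<in> P \<or> (\<exists>u v. u \<in> P \<and> v \<notin> P \<and> {u, v} \<in> E)"
    by (induction rule: rtrancl_induct) (use pq in auto)
  then obtain u v where uv: "u \<in> P" "v \<notin> P" "{u, v} \<in> E" using pq by auto
  then have "v \<in> K" using component_nbhd[OF K, of u v] P by (auto simp: nbhd_def)
  then show thesis using that[of v] uv by (auto simp: nbhd_def insert_commute)
qed

lemma component_subset: "K \<in> V // connected_rel V E \<Longrightarrow> K \<subseteq> V"
  using Union_quotient[OF equiv_connected_rel] by auto

lemma budget_component:
  assumes K: "K \<in> V // connected_rel V E" and "budget c P" "P \<subseteq> K" "P \<noteq> {}"
  shows "budget c K"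
  using assms(2-)
proof (induction "card (K - P)" arbitrary: P rule: less_induct)
  case less
  have finK: "finite K" using component_subset[OF K] finite_V finite_subset by auto
  show ?case
  proof (cases "P = K")
    case False
    obtain v where v: "v \<in> K - P" "nbhd v \<inter> P \<noteq> {}"
      using component_exit[OF K less.prems(2,3) False] by auto
    have "card (K - insert v P) < card (K - P)"
      using v finK by (intro psubset_card_mono) auto
    moreover have "budget c (insert v P)"
      using budget_insert_same less.prems(1) v component_subset[OF K] by auto
    ultimately show ?thesis using less.hyps[of "insert v P"] less.prems(2) v(1) by simp
  qed (use less in simp)
qed

text \<open>The union of the sets chosen for the components determines all of \<open>V\<close>, and
  the degree sums add up because the components partition \<open>V\<close>.\<close>

lemma nullity_le_budgets:
  assumes "\<And>K. K \<in> V // connected_rel V E \<Longrightarrow> budget (c K) K"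
  shows "nullity V E \<sigma> \<le> (\<Sum>K\<in>V // connected_rel V E. c K) + (\<Sum>v\<in>V. vertex_degree E v - 2)"
proof -
  let ?Q = "V // connected_rel V E"
  have "\<forall>K\<in>?Q. \<exists>S. S \<subseteq> V \<and> determines S (closed_nbhd K) \<and>
      card S \<le> c K + (\<Sum>v\<in>K. vertex_degree E v - 2)"
    using assms unfolding budget_def by blast
  from bchoice[OF this] obtain S where S: "\<forall>K\<in>?Q. S K \<subseteq> V \<and> determines (S K) (closed_nbhd K) \<and>
      card (S K) \<le> c K + (\<Sum>v\<in>K. vertex_degree E v - 2)" ..
  have UQ: "\<Union>?Q = V" by (rule Union_quotient[OF equiv_connected_rel])
  have finQ: "finite ?Q" using finite_V UQ finite_UnionD by metis
  have "determines (\<Union>K\<in>?Q. S K) (\<Union>K\<in>?Q. K)"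
  proof (rule determines_UN)
    fix K assume K: "K \<in> ?Q"
    show "determines (\<Union>K\<in>?Q. S K) K"
      by (rule determines_mono[of "S K" "closed_nbhd K"]) (use S K in \<open>auto simp: closed_nbhd_def\<close>)
  qed
  then have "nullity V E \<sigma> \<le> card (\<Union>K\<in>?Q. S K)"
    using UQ S by (intro nullity_le_card) auto
  also have "\<dots> \<le> (\<Sum>K\<in>?Q. card (S K))"
    by (rule card_UN_le[OF finQ])
  also have "\<dots> \<le> (\<Sum>K\<in>?Q. c K + (\<Sum>v\<in>K. vertex_degree E v - 2))"
    using S by (intro sum_mono) auto
  also have "\<dots> = (\<Sum>K\<in>?Q. c K) + (\<Sum>K\<in>?Q. \<Sum>v\<in>K. vertex_degree E v - 2)"
    by (rule sum.distrib)
  also have "(\<Sum>K\<in>?Q. \<Sum>v\<in>K. vertex_degree E v - 2) = (\<Sum>v\<in>\<Union>?Q. vertex_degree E v - 2)"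
  proof (subst sum.Union_disjoint)
    show "\<forall>K\<in>?Q. finite K" using component_subset finite_V finite_subset by metis
    show "\<forall>K\<in>?Q. \<forall>L\<in>?Q. K \<noteq> L \<longrightarrow> K \<inter> L = {}"
      using quotient_disj[OF equiv_connected_rel] by auto
  qed simp
  finally show ?thesis by (simp add: UQ)
qed

lemma budget_2_component:
  assumes K: "K \<in> V // connected_rel V E"
  shows "budget 2 K"
proof -
  obtain v where v: "v \<in> K" using in_quotient_imp_non_empty[OF equiv_connected_rel K] by auto
  then have "budget 2 {v}" using budget_singleton(1) component_subset[OF K] by auto
  then show ?thesis using budget_component[OF K, of 2 "{v}"] v by auto
qed

lemma nullity_le:
  assumes "\<forall>v\<in>V. vertex_degree E v \<noteq> 0"
  shows "int (nullity V E \<sigma>) \<le> int (num_pendant V E) + 2 * cyclomatic V E"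
proof -
  have "nullity V E \<sigma> \<le>
      (\<Sum>K\<in>V // connected_rel V E. 2) + (\<Sum>v\<in>V. vertex_degree E v - 2)"
    by (rule nullity_le_budgets) (rule budget_2_component)
  moreover have "(\<Sum>K\<in>V // connected_rel V E. 2) = 2 * num_components V E"
    by (simp add: num_components_def)
  ultimately show ?thesis
    using pendant_cyclomatic_eq[OF assms] by linarith
qed

text \<open>One component at constant 1 and the others at 2 replace \<open>2c\<close> by
  \<open>2c - 1\<close>, where \<open>c\<close> counts the components.\<close>

lemma nullity_le_saving:
  assumes "\<forall>v\<in>V. vertex_degree E v \<noteq> 0"
    and K: "K \<in> V // connected_rel V E" and b: "budget 1 K"
  shows "int (nullity V E \<sigma>) \<le> int (num_pendant V E) + 2 * cyclomatic V E - 1"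
proof -
  let ?Q = "V // connected_rel V E"
  have finQ: "finite ?Q"
    using finite_V Union_quotient[OF equiv_connected_rel] finite_UnionD by metis
  have "nullity V E \<sigma> \<le>
      (\<Sum>L\<in>?Q. if L = K then 1 else 2) + (\<Sum>v\<in>V. vertex_degree E v - 2)"
    using b budget_2_component by (intro nullity_le_budgets) auto
  moreover have "Suc (\<Sum>L\<in>?Q. if L = K then 1 else 2) = 2 * card ?Q"
  proof -
    have "(\<Sum>L\<in>?Q. if L = K then 1 else 2) = 1 + (\<Sum>L\<in>?Q - {K}. 2 :: nat)"
      using sum.remove[OF finQ K, of "\<lambda>L. if L = K then 1 else 2 :: nat"] by simp
    moreover have "(\<Sum>L\<in>?Q - {K}. 2 :: nat) = 2 * card (?Q - {K})" by simp
    moreover have "card ?Q = Suc (card (?Q - {K}))" by (rule card.remove[OF finQ K])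
    ultimately show ?thesis by linarith
  qed
  ultimately show ?thesis
    using pendant_cyclomatic_eq[OF assms(1)] unfolding num_components_def by linarith
qed

lemma pendant_budget:
  assumes "num_pendant V E \<ge> 1"
  obtains K where "K \<in> V // connected_rel V E" "budget 1 K"
proof -
  have "{v \<in> V. vertex_degree E v = 1} \<noteq> {}"
    using assms unfolding num_pendant_def by (metis card.empty not_one_le_zero)
  then obtain v where v: "v \<in> V" "vertex_degree E v = 1" by auto
  obtain K where K: "K \<in> V // connected_rel V E" "v \<in> K"
    using v Union_quotient[OF equiv_connected_rel] by blast
  show thesis
    using that[OF K(1)] budget_component[OF K(1) budget_singleton(2)[OF v]] K(2) by auto
qed

section \<open>Saving a unit on a cycle\<close>

lemma is_cycleE:
  assumes "is_cycle E C"
  obtains vs where "3 \<le> length vs" "distinct vs" "\<Union>C \<subseteq> set vs" "C \<subseteq> E"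
    "C = {{vs ! i, vs ! (Suc i mod length vs)} | i. i < length vs}"
proof -
  obtain vs where vs: "3 \<le> length vs" "distinct vs" "C \<subseteq> E"
    and C: "C = {{vs ! i, vs ! (Suc i mod length vs)} | i. i < length vs}"
    using assms unfolding is_cycle_def by auto
  have "vs ! (i mod length vs) \<in> set vs" for i
    using vs(1) by (intro nth_mem mod_less_divisor) linarith
  then have "\<Union>C \<subseteq> set vs" unfolding C by auto
  then show thesis using that vs C by blast
qed

text \<open>One vertex of degree at least 3 on the cycle is enough: it is processed last, where
  \<open>budget_insert_saving\<close> lowers the constant from 2 to 1.\<close>

lemma cycle_degree_budget:
  assumes C: "is_cycle E C" and v: "v \<in> \<Union>C" and deg: "vertex_degree E v \<ge> 3"
  obtains K where "K \<in> V // connected_rel V E" "budget 1 K"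
proof -
  obtain vs where vs: "3 \<le> length vs" "distinct vs" "\<Union>C \<subseteq> set vs" and CE: "C \<subseteq> E"
    and Ceq: "C = {{vs ! i, vs ! (Suc i mod length vs)} | i. i < length vs}"
    by (rule is_cycleE[OF C])
  define k where "k = length vs - 1"
  have len: "length vs = Suc k" and k: "2 \<le> k" using vs(1) by (auto simp: k_def)
  have "v \<in> set vs" using v vs(3) by blast
  then obtain j where j: "j < Suc k" "vs ! j = v" using len by (metis in_set_conv_nth)
  \<comment> \<open>The cycle is entered at the successor of \<open>v\<close> and followed once around, so that both cycle
    neighbours of \<open>v\<close> are processed before \<open>v\<close>.\<close>
  define ws where "ws = rotate (Suc j) vs"
  have ws: "length ws = Suc k" "distinct ws" using vs len by (auto simp: ws_def)
  have nth: "ws ! i = vs ! ((Suc j + i) mod Suc k)" if "i < Suc k" for i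
    using that nth_rotate[of i vs "Suc j"] len unfolding ws_def by simp
  have last: "ws ! k = v"
  proof -
    have "(Suc j + k) mod Suc k = j" using j(1) by (metis add_Suc_shift mod_add_self2 mod_less)
    then show ?thesis using nth[of k] j by simp
  qed
  have edge: "{ws ! i, ws ! (Suc i mod Suc k)} \<in> E" if i: "i < Suc k" for i
  proof -
    let ?a = "(Suc j + i) mod Suc k"
    have "(Suc j + Suc i mod Suc k) mod Suc k = Suc ?a mod Suc k"
      by (simp only: mod_add_right_eq mod_Suc_eq add_Suc_right)
    then have "{ws ! i, ws ! (Suc i mod Suc k)} = {vs ! ?a, vs ! (Suc ?a mod Suc k)}"
      using nth i by simp
    moreover have "{vs ! ?a, vs ! (Suc ?a mod Suc k)} \<in> C"
      unfolding Ceq len by (intro CollectI exI[of _ ?a]) simp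
    ultimately show ?thesis using CE by auto
  qed
  have step: "ws ! i \<in> nbhd (ws ! Suc i)" if "i < k" for i
    using edge[of i] that by (simp add: nbhd_def insert_commute)
  have close: "ws ! 0 \<in> nbhd v"
    using edge[of k] last by (simp add: nbhd_def)
  have w0: "ws ! 0 \<in> V" using close nbhd_subset by auto
  obtain K where K: "K \<in> V // connected_rel V E" "ws ! 0 \<in> K"
    using w0 Union_quotient[OF equiv_connected_rel] by blast
  \<comment> \<open>Each new vertex has its predecessor on the cycle among the processed ones, so
    the constant stays 2. Chords do no harm.\<close>
  have prefix: "budget 2 ((!) ws ` {..i}) \<and> (!) ws ` {..i} \<subseteq> K" if "i < k" for i
    using that
  proof (induction i)
    case 0
    then show ?case using budget_singleton(1)[OF w0] K by simp
  next
    case (Suc i)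
    have new: "ws ! Suc i \<notin> (!) ws ` {..i}"
      using ws Suc.prems by (auto simp: nth_eq_iff_index_eq)
    have adj: "ws ! i \<in> nbhd (ws ! Suc i)" using step Suc.prems by simp
    then have inV: "ws ! Suc i \<in> V" using nbhd_sym nbhd_subset by blast
    have "budget 2 (insert (ws ! Suc i) ((!) ws ` {..i}))"
      using Suc new adj inV by (intro budget_insert_same) auto
    moreover have "ws ! Suc i \<in> K"
      using component_nbhd[OF K(1), of "ws ! i" "ws ! Suc i"] Suc adj nbhd_sym by auto
    ultimately show ?case using Suc by (simp add: atMost_Suc)
  qed
  \<comment> \<open>These are all cycle vertices except \<open>v = ws ! k\<close>. Since
    \<open>k \<ge> 2\<close>, the two cycle neighbours \<open>ws ! 0\<close> and
    \<open>ws ! (k - 1)\<close> of \<open>v\<close> are distinct.\<close>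
  define P where "P = (!) ws ` {..k - 1}"
  have P: "budget 2 P" "P \<subseteq> K" using prefix[of "k - 1"] k by (auto simp: P_def)
  have "v \<notin> P" using ws k last by (auto simp: P_def nth_eq_iff_index_eq)
  moreover have "v \<in> V" using close nbhd_sym nbhd_subset by blast
  moreover have "ws ! 0 \<noteq> ws ! (k - 1)" using ws k by (simp add: nth_eq_iff_index_eq)
  moreover have "ws ! (k - 1) \<in> nbhd v" using step[of "k - 1"] k last by simp
  moreover have "ws ! 0 \<in> P" "ws ! (k - 1) \<in> P" by (auto simp: P_def)
  ultimately have "budget 1 (insert v P)"
    using P(1) deg close
    by (intro budget_insert_saving[of 1 P v "ws ! 0" "ws ! (k - 1)"]) (auto simp: numeral_2_eq_2)
  moreover have "v \<in> K" using component_nbhd[OF K close[unfolded nbhd_sym[of _ v]]] .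
  ultimately show thesis
    using that[OF K(1)] budget_component[OF K(1), of 1 "insert v P"] P(2) by auto
qed

subsection \<open>Cycles with a common vertex\<close>

text \<open>The cycle already uses two distinct edges at \<open>v\<close>, and a degree below 3
  leaves no room for another.\<close>

lemma cycle_edges_at_vertex:
  assumes C: "is_cycle E C" and v: "v \<in> \<Union>C" and deg: "vertex_degree E v < 3"
    and e: "e \<in> E" "v \<in> e"
  shows "e \<in> C"
proof -
  obtain vs where vs: "3 \<le> length vs" "distinct vs" "\<Union>C \<subseteq> set vs" and CE: "C \<subseteq> E"
    and Ceq: "C = {{vs ! i, vs ! (Suc i mod length vs)} | i. i < length vs}"
    by (rule is_cycleE[OF C])
  have "v \<in> set vs" using v vs(3) by blast
  then obtain i where i: "i < length vs" "vs ! i = v" by (metis in_set_conv_nth)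
  define n where "n = Suc i mod length vs"
  \<comment> \<open>The predecessor index, wrapping around at 0. Length at least 3 keeps it apart
    from the successor \<open>n\<close>.\<close>
  define p where "p = (if i = 0 then length vs - 1 else i - 1)"
  have n: "n < length vs" using i(1) unfolding n_def by (intro mod_less_divisor) linarith
  have p: "p < length vs" using i(1) by (auto simp: p_def)
  have Sp: "Suc p mod length vs = i" using i vs by (auto simp: p_def)
  have np: "n \<noteq> p" "n \<noteq> i" "p \<noteq> i"
    using i vs(1) by (auto simp: n_def p_def mod_Suc split: if_splits)
  have "{v, vs ! n} \<in> C" using i unfolding Ceq n_def by blast
  moreover have "{vs ! p, v} \<in> C" using p Sp i unfolding Ceq by force
  ultimately have inC: "{{v, vs ! n}, {v, vs ! p}} \<subseteq> C" by (simp add: insert_commute)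
  have "vs ! n \<noteq> vs ! p" using np n p vs by (simp add: nth_eq_iff_index_eq)
  then have "card {{v, vs ! n}, {v, vs ! p}} = 2" by (simp add: doubleton_eq_iff)
  moreover have "{{v, vs ! n}, {v, vs ! p}} \<subseteq> {e \<in> E. v \<in> e}" using inC CE by auto
  moreover have "finite {e \<in> E. v \<in> e}" using finite_E by simp
  ultimately have "{{v, vs ! n}, {v, vs ! p}} = {e \<in> E. v \<in> e}"
    using deg unfolding vertex_degree_def by (intro card_seteq) auto
  then show ?thesis using e inC by auto
qed

text \<open>Follow \<open>C'\<close> from a common vertex: by \<open>cycle_edges_at_vertex\<close>
  each edge leaving a vertex of \<open>C\<close> belongs to \<open>C\<close>, so the walk never
  leaves \<open>C\<close>.\<close>

lemma cycle_subset_if_degrees_less_3: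
  assumes C: "is_cycle E C" and C': "is_cycle E C'" and meet: "\<Union>C \<inter> \<Union>C' \<noteq> {}"
    and deg: "\<And>v. v \<in> \<Union>C \<Longrightarrow> vertex_degree E v < 3"
  shows "C' \<subseteq> C"
proof -
  obtain vs where vs: "3 \<le> length vs" "distinct vs" "\<Union>C' \<subseteq> set vs" and CE: "C' \<subseteq> E"
    and Ceq: "C' = {{vs ! i, vs ! (Suc i mod length vs)} | i. i < length vs}"
    by (rule is_cycleE[OF C'])
  let ?l = "length vs"
  obtain v where v: "v \<in> \<Union>C" "v \<in> \<Union>C'" using meet by auto
  have "v \<in> set vs" using v(2) vs(3) by blast
  then obtain j where j: "j < ?l" "vs ! j = v" by (metis in_set_conv_nth)
  have edge: "{vs ! i, vs ! (Suc i mod ?l)} \<in> C" if "i < ?l" "vs ! i \<in> \<Union>C" for i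
  proof (rule cycle_edges_at_vertex[OF C that(2) deg[OF that(2)]])
    show "{vs ! i, vs ! (Suc i mod ?l)} \<in> E" using CE that(1) unfolding Ceq by blast
  qed simp
  have walk: "vs ! ((j + m) mod ?l) \<in> \<Union>C" for m
  proof (induction m)
    case 0
    then show ?case using j v by simp
  next
    case (Suc m)
    have "(j + m) mod ?l < ?l" using j by (intro mod_less_divisor) linarith
    from edge[OF this Suc] have "vs ! (Suc ((j + m) mod ?l) mod ?l) \<in> \<Union>C" by blast
    then show ?case by (simp add: mod_simps)
  qed
  have "vs ! i \<in> \<Union>C" if "i < ?l" for i
  proof -
    \<comment> \<open>Going from index \<open>j\<close> up to the end and on to \<open>i\<close>
      takes \<open>?l - j + i\<close> steps.\<close>
    have "(j + (?l - j + i)) mod ?l = i" using j that by simp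
    then show ?thesis using walk[of "?l - j + i"] by simp
  qed
  then show ?thesis using edge unfolding Ceq by blast
qed

text \<open>If all degrees on \<open>C\<close> were below 3, then \<open>C' \<subseteq> C\<close>.
  The degree bound would pass to \<open>C'\<close>, and exchanging the cycles would give
  \<open>C = C'\<close>.\<close>

lemma meeting_cycles_degree:
  assumes C: "is_cycle E C" and C': "is_cycle E C'" and "C \<noteq> C'" and meet: "\<Union>C \<inter> \<Union>C' \<noteq> {}"
  obtains v where "v \<in> \<Union>C" "vertex_degree E v \<ge> 3"
proof -
  have "\<exists>v\<in>\<Union>C. vertex_degree E v \<ge> 3"
  proof (rule ccontr)
    assume "\<not> ?thesis"
    then have less: "\<And>v. v \<in> \<Union>C \<Longrightarrow> vertex_degree E v < 3" by (meson not_le)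
    have "C' \<subseteq> C" by (rule cycle_subset_if_degrees_less_3[OF C C' meet less])
    moreover have "C \<subseteq> C'"
    proof (rule cycle_subset_if_degrees_less_3[OF C' C])
      show "vertex_degree E v < 3" if "v \<in> \<Union>C'" for v
        using less \<open>C' \<subseteq> C\<close> that by blast
    qed (use meet in auto)
    ultimately show False using \<open>C \<noteq> C'\<close> by auto
  qed
  then show thesis using that by blast
qed

end

text \<open>Isolated vertices are excluded because each adds 1 to the nullity and nothing to
  \<open>p\<close> or the cyclomatic number: two vertices without an edge have nullity 2 and
  right-hand side 0.\<close>

theorem corollary4p1:
  fixes V :: "'v set" and E :: "'v set set" and \<sigma> :: "'v set \<Rightarrow> edge_sign"
  assumes "simple_graph V E"
    and "card V \<ge> 2"
    and "\<forall>v\<in>V. vertex_degree E v \<noteq> 0"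
  shows "int (nullity V E \<sigma>) \<le> int (num_pendant V E) + 2 * cyclomatic V E \<and>
    (num_pendant V E \<ge> 1 \<or>
      (num_pendant V E = 0 \<and>
        (\<exists>C C'. is_cycle E C \<and> is_cycle E C' \<and> C \<noteq> C' \<and> \<Union>C \<inter> \<Union>C' \<noteq> {})) \<longrightarrow>
     int (nullity V E \<sigma>) \<le> int (num_pendant V E) + 2 * cyclomatic V E - 1)"
proof -
  interpret signed_graph V E \<sigma> using assms(1) by unfold_locales
  have "\<exists>K \<in> V // connected_rel V E. budget 1 K"
    if "num_pendant V E \<ge> 1 \<or> (num_pendant V E = 0 \<and>
        (\<exists>C C'. is_cycle E C \<and> is_cycle E C' \<and> C \<noteq> C' \<and> \<Union>C \<inter> \<Union>C' \<noteq> {}))"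
    using that
  proof
    assume "num_pendant V E \<ge> 1"
    then show ?thesis using pendant_budget by blast
  next
    assume "num_pendant V E = 0 \<and>
      (\<exists>C C'. is_cycle E C \<and> is_cycle E C' \<and> C \<noteq> C' \<and> \<Union>C \<inter> \<Union>C' \<noteq> {})"
    then obtain C C' where C: "is_cycle E C" "is_cycle E C'" "C \<noteq> C'" "\<Union>C \<inter> \<Union>C' \<noteq> {}"
      by blast
    obtain v where "v \<in> \<Union>C" "vertex_degree E v \<ge> 3"
      using meeting_cycles_degree[OF C] by blast
    then show ?thesis using cycle_degree_budget[OF C(1)] by blast
  qed
  then show ?thesis
    using nullity_le[OF assms(3)] nullity_le_saving[OF assms(3)] by blast
qed

end
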